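(* Let $D$ be the $2n\times 2n$ diagonal matrix with $D_{ii}=D_{\tilde i\tilde i}=(-1)^{i-1}$ (rows/columns indexed in the order $1,\tilde1,\dots,n,\tilde n$). (1) Every subspace in $U_{\text{not shorted}}$ is the row span of a matrix $MD$, where $M$ is the $(n+1)\times 2n$ matrix whose first row is $(0,1,0,1,\dots,0,1)$ and whose $(i+1)$-st row ($1\le i\le n$) has entry $1$ in column $i$, entry $0$ in the other columns $j\in[n]$, and entry $S_{ij}$ in column $\tilde j$, for some real $n\times n$ matrix $S$. The matrix $S$ is unique up to adding a multiple of $(1,1,\dots,1)$ to each row, and the $n\times n$ matrix $P$ with entries $P_{ab}=S_{b,a-1}-S_{b,a}$ (indices modulo $n$, so $S_{b,0}=S_{b,n}$) is symmetric with all row and column sums $0$. Conversely, every symmetric $n\times n$ matrix with all row and column sums $0$ arises in this way from a unique point of $U_{\text{not shorted}}$. (2) Similarly, every subspace in $U_{\text{connected}}$ is the row span of a matrix $M'D$, where $M'$ is the $(n+1)\times 2n$ matrix whose first row is $(1,0,1,0,\dots,1,0)$ and whose $(i+1)$-st row ($1\le i\le n$) has entry $T_{ij}$ in column $j\in[n]$, entry $1$ in column $\tilde i$, and $0$ in the other columns $\tilde j$, for some real $n\times n$ matrix $T$, where the $n\times n$ matrix $Q$ with entries $Q_{ab}=T_{b,a+1}-T_{b,a}$ (indices modulo $n$) is symmetric with all row and column sums $0$.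
   Context: Let $V=\mathbb{R}^{2n}$ with basis $e_1,e_{\tilde 1},\dots,e_n,e_{\tilde n}$ ordered $1<\tilde1<2<\dots<n<\tilde n$; matrices representing points of $\mathrm{Gr}(n+1,2n)$ have columns in this order, and a point is the row span. For $I\subseteq[n]$, $\tilde I\subseteq[\tilde n]$ with $|I|+|\tilde I|=n+1$, $\Delta_{I,\tilde I}(X)$ is the maximal minor of a representing matrix in columns $I\sqcup\tilde I$ (Plücker coordinate, defined up to a common scalar). Let $\Omega$ be the skew form \[\Omega(x,y)=\sum_{i=1}^n(x_iy_{\tilde i}-x_{\tilde i}y_i)+\sum_{j=1}^{n-1}(x_{j+1}y_{\tilde j}-x_{\tilde j}y_{j+1})+(-1)^n(x_1y_{\tilde n}-x_{\tilde n}y_1),\] and $\mathrm{IG}^{\Omega}(n+1,2n)$ the set of $(n+1)$-dimensional subspaces isotropic for $\Omega$. $U_{\text{not shorted}}$ is the set of $X\in\mathrm{IG}^{\Omega}(n+1,2n)$ with $\Delta_{[n],\{\tilde k\}}(X)\neq0$ for all $k$, and $U_{\text{connected}}$ the set of $X\in\mathrm{IG}^{\Omega}(n+1,2n)$ with $\Delta_{\{k\},[\tilde n]}(X)\ne0$ for all $k$. *)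

theory Defs
  imports "Jordan_Normal_Form.VS_Connect" "Jordan_Normal_Form.DL_Submatrix"
begin

text \<open>
  Indices are shifted to start at 0: the elements $1, \dots, n$ of $[n]$ (and of $[\tilde n]$)
  become \<open>0, \<dots>, n - 1\<close>. In the column order $1 < \tilde 1 < 2 < \dots < n < \tilde n$,
  index \<open>i < n\<close> of $[n]$ then sits at position \<open>2 * i\<close>, and index \<open>i\<close> of $[\tilde n]$ at
  position \<open>2 * i + 1\<close>.
\<close>

definition col_pos :: "nat \<Rightarrow> nat" where
  "col_pos i = 2 * i"

definition tcol_pos :: "nat \<Rightarrow> nat" where
  "tcol_pos i = 2 * i + 1"

definition Gr :: "nat \<Rightarrow> nat \<Rightarrow> real vec set set" where
  "Gr k m = {X. VectorSpace.subspace class_ring X (module_vec TYPE(real) m) \<and>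
     vectorspace.dim class_ring ((module_vec TYPE(real) m)\<lparr>carrier := X\<rparr>) = k}"

abbreviation row_span :: "nat \<Rightarrow> real mat \<Rightarrow> real vec set" where
  "row_span m A \<equiv> vec_space.row_space m A"

definition represents :: "nat \<Rightarrow> nat \<Rightarrow> real mat \<Rightarrow> real vec set \<Rightarrow> bool" where
  "represents k m A X \<longleftrightarrow> A \<in> carrier_mat k m \<and> row_span m A = X"

text \<open>
  The maximal minor in the columns $I \sqcup \tilde I$. The function \<open>submatrix\<close> keeps the
  selected columns in increasing order of position.
\<close>

definition maximal_minor :: "real mat \<Rightarrow> nat set \<Rightarrow> nat set \<Rightarrow> real" where
  "maximal_minor A I It = det (submatrix A UNIV (col_pos ` I \<union> tcol_pos ` It))"

text \<open>
  Pluecker coordinates of \<open>X\<close> are defined only up to a common nonzero scalar, so only their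
  vanishing is meaningful; lemma \<open>plucker_nonzero_iff\<close> below shows that it does not depend on
  the representing matrix.
\<close>

definition plucker_nonzero :: "nat \<Rightarrow> real vec set \<Rightarrow> nat set \<Rightarrow> nat set \<Rightarrow> bool" where
  "plucker_nonzero n X I It \<longleftrightarrow>
     (\<exists>A. represents (n + 1) (2 * n) A X \<and> maximal_minor A I It \<noteq> 0)"

text \<open>In the last summand the exponent is $n$ itself, hence unaffected by the index shift.\<close>

definition Omega :: "nat \<Rightarrow> real vec \<Rightarrow> real vec \<Rightarrow> real" where
  "Omega n x y =
     (\<Sum>i<n. x $ col_pos i * y $ tcol_pos i - x $ tcol_pos i * y $ col_pos i)
   + (\<Sum>j<n - 1. x $ col_pos (j + 1) * y $ tcol_pos j - x $ tcol_pos j * y $ col_pos (j + 1))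
   + (-1) ^ n * (x $ col_pos 0 * y $ tcol_pos (n - 1) - x $ tcol_pos (n - 1) * y $ col_pos 0)"

definition IG :: "nat \<Rightarrow> real vec set set" where
  "IG n = {X \<in> Gr (n + 1) (2 * n). \<forall>x\<in>X. \<forall>y\<in>X. Omega n x y = 0}"

definition U_not_shorted :: "nat \<Rightarrow> real vec set set" where
  "U_not_shorted n = {X \<in> IG n. \<forall>k<n. plucker_nonzero n X {..<n} {k}}"

definition U_connected :: "nat \<Rightarrow> real vec set set" where
  "U_connected n = {X \<in> IG n. \<forall>k<n. plucker_nonzero n X {k} {..<n}}"

definition D_mat :: "nat \<Rightarrow> real mat" where
  "D_mat n = mat (2 * n) (2 * n) (\<lambda>(r, c). if r = c then (-1) ^ (r div 2) else 0)"

text \<open>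
  In the next two definitions row \<open>0\<close> is the first row of the matrix, and row \<open>i + 1\<close> belongs to
  the (shifted) index \<open>i < n\<close>; a column \<open>c\<close> is \<open>col_pos j\<close> or \<open>tcol_pos j\<close> for
  \<open>j = c div 2\<close>, according to its parity.
\<close>

definition M_mat :: "nat \<Rightarrow> real mat \<Rightarrow> real mat" where
  "M_mat n S = mat (n + 1) (2 * n) (\<lambda>(r, c).
     case r of
       0 \<Rightarrow> (if even c then 0 else 1)
     | Suc i \<Rightarrow> (if even c then (if c div 2 = i then 1 else 0) else S $$ (i, c div 2)))"

definition M'_mat :: "nat \<Rightarrow> real mat \<Rightarrow> real mat" where
  "M'_mat n T = mat (n + 1) (2 * n) (\<lambda>(r, c).
     case r of
       0 \<Rightarrow> (if even c then 1 else 0)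
     | Suc i \<Rightarrow> (if even c then T $$ (i, c div 2) else (if c div 2 = i then 1 else 0)))"

text \<open>The second index is cyclic; \<open>a + n - 1\<close> is $a - 1$ modulo $n$ without truncation.\<close>

definition P_mat :: "nat \<Rightarrow> real mat \<Rightarrow> real mat" where
  "P_mat n S = mat n n (\<lambda>(a, b). S $$ (b, (a + n - 1) mod n) - S $$ (b, a))"

definition Q_mat :: "nat \<Rightarrow> real mat \<Rightarrow> real mat" where
  "Q_mat n T = mat n n (\<lambda>(a, b). T $$ (b, (a + 1) mod n) - T $$ (b, a))"

definition symmetric_zero_sums :: "nat \<Rightarrow> real mat \<Rightarrow> bool" where
  "symmetric_zero_sums n P \<longleftrightarrow> P \<in> carrier_mat n n \<and> P\<^sup>T = P \<and>
     (\<forall>a<n. (\<Sum>b<n. P $$ (a, b)) = 0) \<and> (\<forall>b<n. (\<Sum>a<n. P $$ (a, b)) = 0)"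

lemma same_row_span_factor:
  assumes A: "A \<in> carrier_mat k m" and B: "B \<in> carrier_mat l m"
    and sub: "row_span m B \<subseteq> row_span m A"
  shows "\<exists>C \<in> carrier_mat l k. B = C * A"
proof -
  interpret vec_space "TYPE(real)" m .
  have "\<exists>y \<in> carrier_vec k. A\<^sup>T *\<^sub>v y = row B i" if i: "i < l" for i
  proof -
    have "row B i \<in> set (rows B)" using i B by (auto simp: rows_def)
    moreover have "set (rows B) \<subseteq> carrier_vec m" using B rows_carrier by blast
    ultimately have "row B i \<in> row_space B"
      unfolding row_space_def using span_mem by blast
    then have "row B i \<in> row_space A" using sub by blast
    then show ?thesis unfolding row_space_eq[OF A] using A by auto
  qed
  then obtain y where y: "\<And>i. i < l \<Longrightarrow> y i \<in> carrier_vec k \<and> A\<^sup>T *\<^sub>v y i = row B i"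
    by metis
  define C where "C = mat l k (\<lambda>(i, j). y i $ j)"
  have "B = C * A"
  proof (rule eq_matI)
    fix i j assume "i < dim_row (C * A)" "j < dim_col (C * A)"
    then have i: "i < l" and j: "j < m" using A by (auto simp: C_def)
    have rC: "row C i = y i" using y[OF i] i by (auto simp: C_def)
    have "B $$ (i, j) = row B i $ j" using B i j by simp
    also have "\<dots> = (A\<^sup>T *\<^sub>v y i) $ j" using y[OF i] by simp
    also have "\<dots> = col A j \<bullet> y i" using A j by simp
    also have "\<dots> = y i \<bullet> col A j" using y[OF i] A j by (intro comm_scalar_prod[of _ k]) auto
    also have "\<dots> = (C * A) $$ (i, j)" using rC i j A by (simp add: C_def)
    finally show "B $$ (i, j) = (C * A) $$ (i, j)" .
  qed (use A B in \<open>auto simp: C_def\<close>)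
  then show ?thesis by (intro bexI[of _ C]) (auto simp: C_def)
qed

lemma submatrix_UNIV_mult:
  assumes C: "C \<in> carrier_mat l k" and A: "A \<in> carrier_mat k m"
  shows "submatrix (C * A) UNIV J = C * submatrix A UNIV J"
proof (rule eq_matI)
  let ?c = "card {j. j < m \<and> j \<in> J}"
  have dims: "dim_row (submatrix A UNIV J) = k" "dim_col (submatrix A UNIV J) = ?c"
    "dim_row (submatrix (C * A) UNIV J) = l" "dim_col (submatrix (C * A) UNIV J) = ?c"
    using A C by (auto simp: dim_submatrix)
  show "dim_row (submatrix (C * A) UNIV J) = dim_row (C * submatrix A UNIV J)"
    "dim_col (submatrix (C * A) UNIV J) = dim_col (C * submatrix A UNIV J)"
    using dims C by auto
  fix i j assume "i < dim_row (C * submatrix A UNIV J)" "j < dim_col (C * submatrix A UNIV J)"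
  then have i: "i < l" and j: "j < ?c" using C dims by auto
  have pj: "pick J j < m" using pick_le[OF j] .
  have col: "col (submatrix A UNIV J) j = col A (pick J j)"
  proof (rule eq_vecI)
    fix r assume "r < dim_vec (col A (pick J j))"
    then have r: "r < k" using A by simp
    have "submatrix A UNIV J $$ (r, j) = A $$ (pick UNIV r, pick J j)"
      using r j A by (intro submatrix_index) auto
    then show "col (submatrix A UNIV J) j $ r = col A (pick J j) $ r"
      using r j A pj dims by (simp add: pick_UNIV)
  qed (use A dims in simp)
  have "submatrix (C * A) UNIV J $$ (i, j) = (C * A) $$ (pick UNIV i, pick J j)"
    using i j A C by (intro submatrix_index) auto
  then show "submatrix (C * A) UNIV J $$ (i, j) = (C * submatrix A UNIV J) $$ (i, j)"
    using i j A C pj dims col by (simp add: pick_UNIV)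
qed

lemma maximal_minor_mult:
  assumes C: "C \<in> carrier_mat k k" and A: "A \<in> carrier_mat k m"
    and minor: "card {j. j < m \<and> j \<in> col_pos ` I \<union> tcol_pos ` It} = k"
  shows "maximal_minor (C * A) I It = det C * maximal_minor A I It"
proof -
  have "submatrix A UNIV (col_pos ` I \<union> tcol_pos ` It) \<in> carrier_mat k k"
    using A minor by (intro carrier_matI) (auto simp: dim_submatrix)
  then show ?thesis
    unfolding maximal_minor_def submatrix_UNIV_mult[OF C A] by (rule det_mult[OF C])
qed

lemma plucker_nonzero_iff:
  assumes A: "represents (n + 1) (2 * n) A X"
    and "I \<subseteq> {..<n}" "It \<subseteq> {..<n}" and "card I + card It = n + 1"
  shows "plucker_nonzero n X I It \<longleftrightarrow> maximal_minor A I It \<noteq> 0"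
proof
  assume "plucker_nonzero n X I It"
  then obtain B where B: "represents (n + 1) (2 * n) B X" and nz: "maximal_minor B I It \<noteq> 0"
    unfolding plucker_nonzero_def by blast
  have fin: "finite I" "finite It" using assms(2,3) finite_subset by blast+
  have "{j. j < 2 * n \<and> j \<in> col_pos ` I \<union> tcol_pos ` It} = col_pos ` I \<union> tcol_pos ` It"
    using assms(2,3) by (auto simp: col_pos_def tcol_pos_def subset_iff) 
  moreover have "card (col_pos ` I \<union> tcol_pos ` It) = card I + card It"
  proof -
    have "col_pos ` I \<inter> tcol_pos ` It = {}" by (auto simp: col_pos_def tcol_pos_def) presburger
    moreover have "inj_on col_pos I" "inj_on tcol_pos It"
      by (auto simp: col_pos_def tcol_pos_def inj_on_def)
    ultimately show ?thesis using fin by (simp add: card_Un_disjoint card_image)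
  qed
  ultimately have c: "card {j. j < 2 * n \<and> j \<in> col_pos ` I \<union> tcol_pos ` It} = n + 1"
    using assms(4) by simp
  obtain C where C: "C \<in> carrier_mat (n + 1) (n + 1)" "B = C * A"
    using same_row_span_factor[of A "n + 1" "2 * n" B "n + 1"] A B
    unfolding represents_def by blast
  then show "maximal_minor A I It \<noteq> 0"
    using nz maximal_minor_mult[OF C(1) _ c, of A] A by (auto simp: represents_def)
next
  assume "maximal_minor A I It \<noteq> 0"
  then show "plucker_nonzero n X I It" using A unfolding plucker_nonzero_def by blast
qed

end

theory Submission
  imports Defs "Jordan_Normal_Form.DL_Rank_Submatrix"
begin

text \<open>
  The signs in \<open>D\<close> turn $\Omega$ into the cyclic form
  $\sum_i (x_i - x_{i+1}) y_{\tilde i} - x_{\tilde i} (y_i - y_{i+1})$, indices modulo $n$. Reordering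
  the sum gives the same shape with the roles of $[n]$ and $[\tilde n]$ exchanged, the cyclic shift
  reversed and the sign changed, so both charts are instances of one argument. A nonzero minor gives
  a vector of the subspace that vanishes on one half of the coordinates; isotropy makes its other
  half invariant under the cyclic shift, hence constant. The span of a frame with parameter \<open>S\<close> is
  the graph-like set where $x_{\tilde j} = c + \sum_i x_i S_{ij}$ for some $c$, and $\Omega$ restricted
  to it is, up to sign, $\sum_{a,b} x_a y_b (P_{ab} - P_{ba})$.
\<close>

section \<open>Maximal minors and row spaces\<close>

lemma col_submatrix_UNIV:
  assumes "i < card {j. j < dim_col A \<and> j \<in> J}"
  shows "col (submatrix A UNIV J) i = col A (pick J i)"
  using assms pick_le[OF assms]
  by (intro eq_vecI) (auto simp: dim_submatrix submatrix_index pick_UNIV)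

lemma pick_of_member:
  assumes "c < m" "c \<in> J"
  obtains i where "i < card {j. j < m \<and> j \<in> J}" "pick J i = c"
proof
  have "{a \<in> J. a < c} \<subset> {j. j < m \<and> j \<in> J}" using assms by auto
  then show "card {a \<in> J. a < c} < card {j. j < m \<and> j \<in> J}" by (simp add: psubset_card_mono)
  show "pick J (card {a \<in> J. a < c}) = c" using assms by (rule_tac pick_card_in_set)
qed

text \<open>If the minor vanished, the transposed submatrix would kill some nonzero
  \<open>v\<close>; its entries at \<open>v\<close> are the pairings of \<open>v\<close> with the
  selected columns of \<open>A\<close>, so \<open>ker\<close> gives a contradiction.\<close>

lemma det_submatrix_nonzero:
  fixes A :: "real mat"
  assumes A: "A \<in> carrier_mat k m" and card: "card {j. j < m \<and> j \<in> J} = k"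
    and ker: "\<And>y. y \<in> carrier_vec k \<Longrightarrow> (\<And>c. c < m \<Longrightarrow> c \<in> J \<Longrightarrow> col A c \<bullet> y = 0) \<Longrightarrow> y = 0\<^sub>v k"
  shows "det (submatrix A UNIV J) \<noteq> 0"
proof
  let ?R = "submatrix A UNIV J"
  have R: "?R \<in> carrier_mat k k" using A card by (intro carrier_matI) (auto simp: dim_submatrix)
  assume "det ?R = 0"
  then have "det ?R\<^sup>T = 0" using det_transpose[OF R] by simp
  then obtain v where v: "v \<in> carrier_vec k" "v \<noteq> 0\<^sub>v k" "?R\<^sup>T *\<^sub>v v = 0\<^sub>v k"
    using det_0_iff_vec_prod_zero[of "?R\<^sup>T" k] R by auto
  have "col A c \<bullet> v = 0" if c: "c < m" "c \<in> J" for c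
  proof -
    obtain i where i: "i < card {j. j < m \<and> j \<in> J}" "pick J i = c" using pick_of_member[OF c] .
    have "col A c \<bullet> v = (?R\<^sup>T *\<^sub>v v) $ i"
      using i A R card by (simp add: col_submatrix_UNIV)
    then show ?thesis using v(3) i card by simp
  qed
  then show False using ker[OF v(1)] v(2) by blast
qed

text \<open>The row space is the column space of the transpose, whose rank is at most its number
  \<open>k\<close> of columns and at least the size of a nonvanishing minor.\<close>

lemma row_space_in_Gr:
  assumes A: "A \<in> carrier_mat k m" and card: "card {j. j < m \<and> j \<in> J} = k"
    and nz: "det (submatrix A UNIV J) \<noteq> 0"
  shows "row_span m A \<in> Gr k m"
proof -
  interpret vec_space "TYPE(real)" m .
  have R: "submatrix A UNIV J \<in> carrier_mat k k"
    using A card by (intro carrier_matI) (auto simp: dim_submatrix)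
  have AT: "A\<^sup>T \<in> carrier_mat m k" using A by simp
  have "submatrix A\<^sup>T J UNIV = (submatrix A UNIV J)\<^sup>T"
    using A by (intro eq_matI) (auto simp: dim_submatrix submatrix_index pick_UNIV pick_le)
  then have "det (submatrix A\<^sup>T J UNIV) \<noteq> 0" using nz det_transpose[OF R] by simp
  from rank_gt_minor[OF AT this] have "k \<le> rank A\<^sup>T" by simp
  then have rk: "rank A\<^sup>T = k" using rank_le_nc[OF AT] by simp
  have sub: "set (rows A) \<subseteq> carrier_vec m" using A rows_carrier by blast
  have "VectorSpace.subspace class_ring (span (set (rows A))) V"
    using span_is_subspace[OF sub] by simp
  then show ?thesis
    using rk unfolding Gr_def row_space_def rank_def by simp
qed

lemma mem_row_space:
  assumes "A \<in> carrier_mat k m"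
  shows "x \<in> row_span m A \<longleftrightarrow> (\<exists>y\<in>carrier_vec k. x = A\<^sup>T *\<^sub>v y)"
  using assms unfolding vec_space.row_space_eq[OF assms] by auto

lemma row_mem_row_space:
  assumes A: "A \<in> carrier_mat k m" and i: "i < k"
  shows "row A i \<in> row_span m A"
proof -
  interpret vec_space "TYPE(real)" m .
  have "row A i \<in> set (rows A)" using i A by (auto simp: rows_def)
  moreover have "set (rows A) \<subseteq> carrier_vec m" using A rows_carrier by blast
  ultimately show ?thesis
    unfolding row_space_def using span_mem by blast
qed

text \<open>Left multiplication by an invertible matrix keeps the row span, and one such matrix
  carries the selected columns of \<open>A\<close> to those of \<open>B\<close>.\<close>

lemma row_space_prescribed_columns:
  fixes A B :: "real mat"
  assumes A: "A \<in> carrier_mat k m" and B: "B \<in> carrier_mat k m"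
    and card: "card {j. j < m \<and> j \<in> J} = k"
    and nzA: "det (submatrix A UNIV J) \<noteq> 0" and nzB: "det (submatrix B UNIV J) \<noteq> 0"
  obtains B' where "B' \<in> carrier_mat k m" "row_span m B' = row_span m A"
    "\<And>c. c < m \<Longrightarrow> c \<in> J \<Longrightarrow> col B' c = col B c"
proof -
  let ?A = "submatrix A UNIV J" and ?B = "submatrix B UNIV J"
  have sA: "?A \<in> carrier_mat k k" and sB: "?B \<in> carrier_mat k k"
    using A B card by (auto intro!: carrier_matI simp: dim_submatrix)
  obtain N where N: "N \<in> carrier_mat k k" "N * ?A = 1\<^sub>m k"
    using det_non_zero_imp_unit[OF sA nzA] unfolding Units_def by (auto simp: ring_mat_def)
  \<comment> \<open>\<open>N\<close> inverts \<open>?A\<close>, so \<open>C\<close> is the only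
    candidate with \<open>C * ?A = ?B\<close>; multiplicativity of \<open>det\<close> makes it
    invertible because \<open>det ?B\<close> is nonzero.\<close>
  define C where "C = ?B * N"
  have C: "C \<in> carrier_mat k k" using sB N by (simp add: C_def)
  have CA: "C * ?A = ?B" unfolding C_def using assoc_mult_mat[OF sB N(1) sA] N(2) sB by simp
  have "det C \<noteq> 0" using det_mult[OF C sA] CA nzB by auto
  then have "C \<in> Units (ring_mat TYPE(real) k ())" by (rule det_non_zero_imp_unit[OF C])
  then obtain E where "E \<in> carrier_mat k k" "E * C = 1\<^sub>m k" "C * E = 1\<^sub>m k"
    unfolding Units_def by (auto simp: ring_mat_def)
  then have inv: "invertible_mat C"
    using C unfolding invertible_mat_def inverts_mat_def by auto
  show thesis
  proof
    show CA': "C * A \<in> carrier_mat k m" using C A by simp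
    show "row_span m (C * A) = row_span m A"
      using vec_space.row_space_is_preserved[OF inv C A] .
    fix c assume c: "c < m" "c \<in> J"
    obtain i where i: "i < card {j. j < m \<and> j \<in> J}" "pick J i = c" using pick_of_member[OF c] .
    have "col (C * A) c = col (submatrix (C * A) UNIV J) i"
      using i A CA' by (simp add: col_submatrix_UNIV)
    also have "submatrix (C * A) UNIV J = ?B" using submatrix_UNIV_mult[OF C A] CA by simp
    also have "col ?B i = col B c" using i B by (simp add: col_submatrix_UNIV)
    finally show "col (C * A) c = col B c" .
  qed
qed

section \<open>Signed coordinates\<close>

text \<open>
  The flag \<open>e\<close> is \<open>True\<close> for the chart not shorted, where the unit vectors occupy $[n]$, and \<open>False\<close>
  for the connected chart, where they occupy $[\tilde n]$.
\<close>

definition pos :: "bool \<Rightarrow> nat \<Rightarrow> nat" where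
  "pos e i = (if e then col_pos i else tcol_pos i)"

text \<open>The sign is the entry of the involution \<open>D\<close> at both positions of index
  \<open>j\<close>, so these are the entries of \<open>x\<close> with \<open>D\<close>
  undone.\<close>

definition coord :: "bool \<Rightarrow> real vec \<Rightarrow> nat \<Rightarrow> real" where
  "coord e x j = (-1) ^ j * x $ pos e j"

text \<open>The off-diagonal terms of the form couple index \<open>i + 1\<close> of [n] with index
  \<open>i\<close> of the other half, cyclically: a step back seen from [n], a step forward seen
  from the other half.\<close>

definition shift :: "bool \<Rightarrow> nat \<Rightarrow> nat \<Rightarrow> nat" where
  "shift e n a = (if e then (a + n - 1) mod n else (a + 1) mod n)"

definition minor_cols :: "bool \<Rightarrow> nat \<Rightarrow> nat \<Rightarrow> nat set" where
  "minor_cols e n k = insert (pos (\<not> e) k) (pos e ` {..<n})"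

text \<open>A common formula for $MD$ and $M'D$; the leading sign is the column scaling by
  \<open>D\<close>.\<close>

definition frame :: "bool \<Rightarrow> nat \<Rightarrow> real mat \<Rightarrow> real mat" where
  "frame e n S = mat (n + 1) (2 * n) (\<lambda>(r, c). (-1) ^ (c div 2) *
     (case r of
        0 \<Rightarrow> (if even c = e then 0 else 1)
      | Suc i \<Rightarrow> (if even c = e then of_bool (c div 2 = i) else S $$ (i, c div 2))))"

definition diff_mat :: "bool \<Rightarrow> nat \<Rightarrow> real mat \<Rightarrow> real mat" where
  "diff_mat e n S = mat n n (\<lambda>(a, b). S $$ (b, shift e n a) - S $$ (b, a))"

lemma pos_props [simp]:
  "even (pos e j) = e" "pos e j div 2 = j" "pos e j < 2 * n \<longleftrightarrow> j < n"
  by (auto simp: pos_def col_pos_def tcol_pos_def)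

lemma pos_eq_iff: "c = pos e j \<longleftrightarrow> c div 2 = j \<and> even c = e"
  by (auto simp: pos_def col_pos_def tcol_pos_def)

lemma pos_cases:
  assumes "c < 2 * n"
  obtains j where "j < n" "c = pos e j" | j where "j < n" "c = pos (\<not> e) j"
proof (cases "even c = e")
  case True
  then show ?thesis using that(1)[of "c div 2"] assms by (simp add: pos_eq_iff)
next
  case False
  then show ?thesis using that(2)[of "c div 2"] assms by (simp add: pos_eq_iff)
qed

lemma frame_carrier [simp]: "frame e n S \<in> carrier_mat (n + 1) (2 * n)"
  by (simp add: frame_def)

lemma frame_index:
  assumes "j < n"
  shows "frame e n S $$ (0, pos e j) = 0"
    and "frame e n S $$ (0, pos (\<not> e) j) = (-1) ^ j"
    and "i < n \<Longrightarrow> frame e n S $$ (Suc i, pos e j) = (-1) ^ j * of_bool (j = i)"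
    and "i < n \<Longrightarrow> frame e n S $$ (Suc i, pos (\<not> e) j) = (-1) ^ j * S $$ (i, j)"
  using assms unfolding frame_def by simp_all

lemma coord_eqD:
  assumes "x \<in> carrier_vec (2 * n)" "y \<in> carrier_vec (2 * n)"
    and "\<And>j. j < n \<Longrightarrow> coord e x j = coord e y j"
    and "\<And>j. j < n \<Longrightarrow> coord (\<not> e) x j = coord (\<not> e) y j"
  shows "x = y"
proof (rule eq_vecI)
  fix c assume "c < dim_vec y"
  then have "c < 2 * n" using assms(2) by simp
  then show "x $ c = y $ c"
    by (cases rule: pos_cases[of _ _ e]) (use assms(3,4) in \<open>auto simp: coord_def\<close>)
qed (use assms in auto)

text \<open>The signs in \<open>frame\<close> and in \<open>coord\<close> cancel. The coefficients
  of the lower rows reappear as \<open>e\<close> coordinates, and that of the first row is a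
  constant added to all other coordinates.\<close>

lemma coord_frame:
  assumes y: "y \<in> carrier_vec (n + 1)" and j: "j < n"
  shows "coord e ((frame e n S)\<^sup>T *\<^sub>v y) j = y $ Suc j"
    and "coord (\<not> e) ((frame e n S)\<^sup>T *\<^sub>v y) j = y $ 0 + (\<Sum>i<n. y $ Suc i * S $$ (i, j))"
proof -
  have sgn: "(-1) ^ j * ((-1) ^ j * t) = t" for t :: real
    by (simp flip: mult.assoc power_mult_distrib)
  have *: "((frame e n S)\<^sup>T *\<^sub>v y) $ pos e' j = (\<Sum>r<Suc n. frame e n S $$ (r, pos e' j) * y $ r)" for e'
    using y j by (simp add: scalar_prod_def frame_def lessThan_atLeast0)
  have "((frame e n S)\<^sup>T *\<^sub>v y) $ pos e j = (\<Sum>i<n. (-1) ^ j * (of_bool (j = i) * y $ Suc i))"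
    unfolding * sum.lessThan_Suc_shift by (simp add: frame_index[OF j] mult.assoc)
  also have "\<dots> = (-1) ^ j * y $ Suc j"
    using j by (simp add: of_bool_def if_distrib if_distribR sum.If_cases flip: sum_distrib_left cong: if_cong)
  finally show "coord e ((frame e n S)\<^sup>T *\<^sub>v y) j = y $ Suc j"
    unfolding coord_def by (simp add: sgn)
  have "((frame e n S)\<^sup>T *\<^sub>v y) $ pos (\<not> e) j
      = (-1) ^ j * (y $ 0 + (\<Sum>i<n. y $ Suc i * S $$ (i, j)))"
    unfolding * sum.lessThan_Suc_shift
    by (simp add: frame_index[OF j] distrib_left sum_distrib_left mult_ac)
  then show "coord (\<not> e) ((frame e n S)\<^sup>T *\<^sub>v y) j = y $ 0 + (\<Sum>i<n. y $ Suc i * S $$ (i, j))"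
    unfolding coord_def by (simp add: sgn)
qed

lemma row_space_frame:
  "x \<in> row_span (2 * n) (frame e n S) \<longleftrightarrow> x \<in> carrier_vec (2 * n) \<and>
     (\<exists>c. \<forall>j<n. coord (\<not> e) x j = c + (\<Sum>i<n. coord e x i * S $$ (i, j)))"
proof -
  have carrier: "(frame e n S)\<^sup>T *\<^sub>v y \<in> carrier_vec (2 * n)"
    if "y \<in> carrier_vec (n + 1)" for y
    using frame_carrier[of e n S] that by (metis mult_mat_vec_carrier transpose_carrier_mat)
  have "\<exists>y\<in>carrier_vec (n + 1). x = (frame e n S)\<^sup>T *\<^sub>v y"
    if x: "x \<in> carrier_vec (2 * n)"
      and c: "\<forall>j<n. coord (\<not> e) x j = c + (\<Sum>i<n. coord e x i * S $$ (i, j))" for c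
  proof
    \<comment> \<open>By \<open>coord_frame\<close> the coefficients are forced: the constant
      \<open>c\<close> for the first row, the \<open>e\<close> coordinates of \<open>x\<close> for
      the others.\<close>
    define y where "y = vec (n + 1) (\<lambda>r. case r of 0 \<Rightarrow> c | Suc i \<Rightarrow> coord e x i)"
    show y: "y \<in> carrier_vec (n + 1)" by (simp add: y_def)
    show "x = (frame e n S)\<^sup>T *\<^sub>v y"
      by (rule coord_eqD[OF x carrier[OF y], of e]) (use c in \<open>simp_all only: coord_frame[OF y], simp_all add: y_def\<close>)
  qed
  moreover have "\<exists>c. \<forall>j<n. coord (\<not> e) x j = c + (\<Sum>i<n. coord e x i * S $$ (i, j))"
    if "y \<in> carrier_vec (n + 1)" "x = (frame e n S)\<^sup>T *\<^sub>v y" for y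
    unfolding that(2) using coord_frame[OF that(1), of _ e S]
    by (intro exI[of _ "y $ 0"]) simp
  ultimately show ?thesis
    unfolding mem_row_space[OF frame_carrier] using carrier by blast
qed

section \<open>Distinguished minors of a frame\<close>

lemma card_minor_cols:
  assumes "k < n"
  shows "card {j. j < 2 * n \<and> j \<in> minor_cols e n k} = n + 1"
proof -
  have "{j. j < 2 * n \<and> j \<in> minor_cols e n k} = minor_cols e n k"
    using assms by (auto simp: minor_cols_def)
  moreover have "pos (\<not> e) k \<notin> pos e ` {..<n}"
  proof
    assume "pos (\<not> e) k \<in> pos e ` {..<n}"
    then obtain j where "pos (\<not> e) k = pos e j" by blast
    then show False using pos_props(1)[of "\<not> e" k] pos_props(1)[of e j] by simp
  qed
  moreover have "inj_on (pos e) {..<n}"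
    by (rule inj_on_inverseI[of _ "\<lambda>c. c div 2"]) simp
  ultimately show ?thesis by (simp add: minor_cols_def card_image)
qed

text \<open>If a combination of the rows vanishes in the selected columns, the \<open>n\<close>
  unit-vector columns kill the coefficients of the lower rows, and the extra column then kills that
  of the first.\<close>

lemma frame_minor_nonzero:
  assumes "k < n"
  shows "det (submatrix (frame e n S) UNIV (minor_cols e n k)) \<noteq> 0"
proof (rule det_submatrix_nonzero[OF frame_carrier card_minor_cols[OF assms]])
  fix y assume y: "y \<in> carrier_vec (n + 1)"
    and "\<And>c. c < 2 * n \<Longrightarrow> c \<in> minor_cols e n k \<Longrightarrow> col (frame e n S) c \<bullet> y = 0"
  then have z: "((frame e n S)\<^sup>T *\<^sub>v y) $ c = 0" if "c < 2 * n" "c \<in> minor_cols e n k" for c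
    using that by (simp add: frame_def)
  have s: "y $ Suc j = 0" if "j < n" for j
    using coord_frame(1)[OF y that, of e S] z[of "pos e j"] that
    by (simp add: coord_def minor_cols_def)
  have "y $ 0 = 0"
    using coord_frame(2)[OF y assms, of e S] z[of "pos (\<not> e) k"] assms s
    by (simp add: coord_def minor_cols_def)
  with s show "y = 0\<^sub>v (n + 1)"
    using y by (intro eq_vecI) (auto simp: less_Suc_eq_0_disj)
qed

section \<open>The skew form in signed coordinates\<close>

text \<open>The sum of \<open>h\<close> over the cyclic pairs (i + 1, i), indexed by the second
  entry; \<open>sum_shift_True\<close> indexes the same sum by the first entry.\<close>

lemma sum_shift_False: "(\<Sum>i<Suc m. h (shift False (Suc m) i) i) = (\<Sum>i<m. h (Suc i) i) + h 0 m"
  for h :: "nat \<Rightarrow> nat \<Rightarrow> real"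
  by (simp add: shift_def)

lemma sum_shift_True: "(\<Sum>i<Suc m. h i (shift True (Suc m) i)) = (\<Sum>i<m. h (Suc i) i) + h 0 m"
  for h :: "nat \<Rightarrow> nat \<Rightarrow> real"
proof -
  have "Suc (i + m) mod Suc m = i" if "i < m" for i
    using that by (metis add_Suc_right less_SucI mod_add_self2 mod_less)
  then show ?thesis unfolding sum.lessThan_Suc_shift by (simp add: shift_def)
qed

text \<open>Consecutive indices carry opposite signs, so each neighbour term changes sign; the
  wrap-around pair carries $(-1)^{n-1}$, which turns the factor $(-1)^n$ into -1 as well. What
  remains is cyclic.\<close>

lemma Omega_coord:
  assumes "n \<ge> 1"
  shows "Omega n x y = (if e then 1 else -1) * (\<Sum>i<n.
      coord e x i * (coord (\<not> e) y i - coord (\<not> e) y (shift e n i))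
    - coord e y i * (coord (\<not> e) x i - coord (\<not> e) x (shift e n i)))"
proof -
  obtain m where n: "n = Suc m" using assms by (cases n) auto
  define h where "h i j = coord True x i * coord False y j - coord False x j * coord True y i" for i j
  have sq: "(-1) ^ i * ((-1) ^ i * t) = t" for i and t :: real
    by (simp flip: mult.assoc power_mult_distrib)
  have diag: "h i i = x $ col_pos i * y $ tcol_pos i - x $ tcol_pos i * y $ col_pos i" for i
    by (simp add: h_def coord_def pos_def sq mult_ac)
  have off: "- h (Suc j) j
      = x $ col_pos (j + 1) * y $ tcol_pos j - x $ tcol_pos j * y $ col_pos (j + 1)" for j
    by (simp add: h_def coord_def pos_def sq mult_ac)
  have wrap: "- h 0 m = (-1) ^ n *
      (x $ col_pos 0 * y $ tcol_pos m - x $ tcol_pos m * y $ col_pos 0)"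
    by (simp add: h_def coord_def pos_def n algebra_simps)
  have O: "Omega n x y = (\<Sum>i<n. h i i) - ((\<Sum>j<m. h (Suc j) j) + h 0 m)"
    unfolding Omega_def using wrap unfolding diag[symmetric] off[symmetric]
    by (simp add: n sum_negf)
  show ?thesis
  proof (cases e)
    case True
    have "Omega n x y = (\<Sum>i<n. h i i - h i (shift True n i))"
      using O sum_shift_True[of h m] by (simp only: sum_subtractf n)
    then show ?thesis using True by (simp add: h_def algebra_simps)
  next
    case False
    \<comment> \<open>Indexing by the second entry makes the tilde half the leading one; since the
      form is skew, this exchange costs the sign.\<close>
    have "Omega n x y = - (\<Sum>i<n. h (shift False n i) i - h i i)"
      using O sum_shift_False[of h m] by (simp only: sum_subtractf n minus_diff_eq)
    then show ?thesis using False by (simp add: h_def algebra_simps)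
  qed
qed

section \<open>Isotropy of frame spans and ambiguity of the parameter\<close>

lemma shift_less: "n \<ge> 1 \<Longrightarrow> shift e n i < n"
  by (simp add: shift_def)

text \<open>Of two neighbouring indices, one is the shift of the other, whichever direction
  \<open>e\<close> selects.\<close>

lemma shift_invariant_const:
  fixes f :: "nat \<Rightarrow> real"
  assumes inv: "\<And>a. a < n \<Longrightarrow> f (shift e n a) = f a" and "j < n"
  shows "f j = f 0"
  using assms(2)
proof (induction j)
  case (Suc j)
  then have "f (Suc j) = f j"
    using inv[of j] inv[of "Suc j"] by (cases e) (auto simp: shift_def)
  with Suc show ?case by simp
qed simp

text \<open>The free constant of \<open>row_space_frame\<close> cancels in differences of
  neighbouring coordinates, leaving a bilinear expression in the \<open>e\<close> coordinates.
  Isotropy thus amounts to symmetry of \<open>diff_mat\<close>.\<close>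

lemma Omega_frame:
  assumes n: "n \<ge> 1"
    and x: "x \<in> row_span (2 * n) (frame e n S)" and y: "y \<in> row_span (2 * n) (frame e n S)"
  shows "Omega n x y = (if e then -1 else 1) * (\<Sum>a<n. \<Sum>b<n.
      coord e x a * coord e y b * (diff_mat e n S $$ (a, b) - diff_mat e n S $$ (b, a)))"
proof -
  have d: "coord (\<not> e) z i - coord (\<not> e) z (shift e n i)
      = - (\<Sum>b<n. coord e z b * diff_mat e n S $$ (i, b))"
    if z: "z \<in> row_span (2 * n) (frame e n S)" and i: "i < n" for z i
    using z i shift_less[OF n, of e i] unfolding row_space_frame
    by (auto simp: diff_mat_def algebra_simps sum_subtractf)
  let ?P = "diff_mat e n S"
  have "(\<Sum>i<n. coord e x i * (coord (\<not> e) y i - coord (\<not> e) y (shift e n i))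
    - coord e y i * (coord (\<not> e) x i - coord (\<not> e) x (shift e n i)))
    = (\<Sum>b<n. \<Sum>a<n. coord e y b * coord e x a * ?P $$ (b, a))
      - (\<Sum>a<n. \<Sum>b<n. coord e x a * coord e y b * ?P $$ (a, b))"
    by (simp add: d[OF x] d[OF y] sum_distrib_left sum_negf mult.assoc sum_subtractf)
  also have "(\<Sum>b<n. \<Sum>a<n. coord e y b * coord e x a * ?P $$ (b, a))
      = (\<Sum>a<n. \<Sum>b<n. coord e x a * coord e y b * ?P $$ (b, a))"
    by (subst sum.swap) (simp add: mult_ac)
  finally show ?thesis
    unfolding Omega_coord[OF n, of x y e]
    by (simp add: right_diff_distrib sum_subtractf)
qed

lemma row_space_frame_coord:
  obtains x where "x \<in> row_span (2 * n) (frame e n S)" "\<And>j. j < n \<Longrightarrow> coord e x j = u j"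
proof
  \<comment> \<open>At \<open>r = 0\<close> the truncated subtraction yields \<open>u 0\<close>, an
    arbitrary coefficient of the first row, which does not affect the \<open>e\<close>
    coordinates.\<close>
  let ?y = "vec (n + 1) (\<lambda>r. u (r - 1))"
  have y: "?y \<in> carrier_vec (n + 1)" by simp
  show "(frame e n S)\<^sup>T *\<^sub>v ?y \<in> row_span (2 * n) (frame e n S)"
    unfolding mem_row_space[OF frame_carrier] using y by blast
  show "coord e ((frame e n S)\<^sup>T *\<^sub>v ?y) j = u j" if "j < n" for j
    unfolding coord_frame(1)[OF y that] using that by simp
qed

text \<open>Changing row \<open>i\<close> of \<open>S\<close> by a constant adds a multiple of the
  first row of the frame to a lower row. Conversely, a vector of the span whose \<open>e\<close>
  coordinates form a unit vector reveals row \<open>i\<close> up to a constant.\<close>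

lemma row_space_frame_eq_iff:
  "row_span (2 * n) (frame e n S) = row_span (2 * n) (frame e n S') \<longleftrightarrow>
     (\<exists>c. \<forall>i<n. \<forall>j<n. S' $$ (i, j) = S $$ (i, j) + c i)"
proof
  assume eq: "row_span (2 * n) (frame e n S) = row_span (2 * n) (frame e n S')"
  have "\<exists>c. \<forall>j<n. S' $$ (i, j) = S $$ (i, j) + c" if i: "i < n" for i
  proof -
    obtain x where x: "x \<in> row_span (2 * n) (frame e n S)"
      and u: "\<And>j. j < n \<Longrightarrow> coord e x j = of_bool (j = i)"
      using row_space_frame_coord[of n e S "\<lambda>j. of_bool (j = i)"] by blast
    have s: "(\<Sum>l<n. coord e x l * R $$ (l, j)) = R $$ (i, j)" for R :: "real mat" and j
    proof -
      have "(\<Sum>l<n. coord e x l * R $$ (l, j)) = (\<Sum>l<n. if l = i then R $$ (l, j) else 0)"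
        using u by (intro sum.cong) auto
      then show ?thesis using i by simp
    qed
    obtain c c' where "\<forall>j<n. coord (\<not> e) x j = c + S $$ (i, j)"
      "\<forall>j<n. coord (\<not> e) x j = c' + S' $$ (i, j)"
      using x x[unfolded eq] unfolding row_space_frame s by blast
    then show ?thesis by (intro exI[of _ "c - c'"]) (smt (verit))
  qed
  then show "\<exists>c. \<forall>i<n. \<forall>j<n. S' $$ (i, j) = S $$ (i, j) + c i" by metis
next
  have sub: "row_span (2 * n) (frame e n S) \<subseteq> row_span (2 * n) (frame e n S')"
    if c: "\<forall>i<n. \<forall>j<n. S' $$ (i, j) = S $$ (i, j) + c i" for c S S'
  proof
    fix x assume "x \<in> row_span (2 * n) (frame e n S)"
    then obtain d where x: "x \<in> carrier_vec (2 * n)"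
      and d: "\<forall>j<n. coord (\<not> e) x j = d + (\<Sum>i<n. coord e x i * S $$ (i, j))"
      unfolding row_space_frame by blast
    \<comment> \<open>The change of parameter is absorbed into the free constant, which depends on
      \<open>x\<close> but not on \<open>j\<close>.\<close>
    have "coord (\<not> e) x j
        = d - (\<Sum>i<n. coord e x i * c i) + (\<Sum>i<n. coord e x i * S' $$ (i, j))" if "j < n" for j
      using d c that by (simp add: distrib_left sum.distrib)
    then show "x \<in> row_span (2 * n) (frame e n S')"
      unfolding row_space_frame using x by blast
  qed
  assume "\<exists>c. \<forall>i<n. \<forall>j<n. S' $$ (i, j) = S $$ (i, j) + c i"
  then obtain c where c: "\<forall>i<n. \<forall>j<n. S' $$ (i, j) = S $$ (i, j) + c i" by blast
  then have "\<forall>i<n. \<forall>j<n. S $$ (i, j) = S' $$ (i, j) + (- c i)" by simp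
  with c show "row_span (2 * n) (frame e n S) = row_span (2 * n) (frame e n S')"
    using sub[of S' S c] sub[of S S' "\<lambda>i. - c i"] by blast
qed

lemma frame_in_IG:
  assumes n: "n \<ge> 1"
    and sym: "\<And>a b. a < n \<Longrightarrow> b < n \<Longrightarrow> diff_mat e n S $$ (a, b) = diff_mat e n S $$ (b, a)"
  shows "row_span (2 * n) (frame e n S) \<in> IG n"
proof -
  have "row_span (2 * n) (frame e n S) \<in> Gr (n + 1) (2 * n)"
    by (rule row_space_in_Gr[OF frame_carrier card_minor_cols[of 0] frame_minor_nonzero[of 0]])
      (use n in auto)
  then show ?thesis
    unfolding IG_def using Omega_frame[OF n, of _ e S] sym by simp
qed

text \<open>Evaluating the form on two vectors with unit \<open>e\<close> coordinates isolates a
  single difference of entries.\<close>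

lemma diff_mat_symmetric:
  assumes n: "n \<ge> 1" and IG: "row_span (2 * n) (frame e n S) \<in> IG n" and a: "a < n" and b: "b < n"
  shows "diff_mat e n S $$ (a, b) = diff_mat e n S $$ (b, a)"
proof -
  let ?P = "\<lambda>a b. diff_mat e n S $$ (a, b) - diff_mat e n S $$ (b, a)"
  obtain x where x: "x \<in> row_span (2 * n) (frame e n S)"
    and ux: "\<And>j. j < n \<Longrightarrow> coord e x j = of_bool (j = a)"
    using row_space_frame_coord[of n e S "\<lambda>j. of_bool (j = a)"] by blast
  obtain y where y: "y \<in> row_span (2 * n) (frame e n S)"
    and uy: "\<And>j. j < n \<Longrightarrow> coord e y j = of_bool (j = b)"
    using row_space_frame_coord[of n e S "\<lambda>j. of_bool (j = b)"] by blast
  have "(\<Sum>i<n. \<Sum>j<n. coord e x i * coord e y j * ?P i j)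
      = (\<Sum>i<n. \<Sum>j<n. if i = a then if j = b then ?P i j else 0 else 0)"
    using ux uy by (intro sum.cong) auto
  also have "\<dots> = (\<Sum>i<n. if i = a then ?P i b else 0)"
    using b by (intro sum.cong) auto
  also have "\<dots> = ?P a b" using a by simp
  finally show ?thesis
    using Omega_frame[OF n x y] x y IG unfolding IG_def by (auto split: if_splits)
qed

section \<open>Zero sums and the normal form of isotropic subspaces\<close>

lemma sum_shift:
  fixes f :: "nat \<Rightarrow> real"
  assumes "n \<ge> 1"
  shows "(\<Sum>i<n. f (shift e n i)) = (\<Sum>i<n. f i)"
proof -
  obtain m where n: "n = Suc m" using assms by (cases n) auto
  show ?thesis
  proof (cases e)
    case True
    then show ?thesis using sum_shift_True[of "\<lambda>i j. f j" m] by (simp add: n)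
  next
    case False
    then show ?thesis
      using sum_shift_False[of "\<lambda>i j. f i" m] sum.lessThan_Suc_shift[of f m] by (simp only: n)
  qed
qed

text \<open>Column sums telescope around the cycle; symmetry, which comes from isotropy, carries
  this over to row sums.\<close>

lemma diff_mat_symmetric_zero_sums:
  assumes n: "n \<ge> 1" and IG: "row_span (2 * n) (frame e n S) \<in> IG n"
  shows "symmetric_zero_sums n (diff_mat e n S)"
proof -
  have carrier: "diff_mat e n S \<in> carrier_mat n n" by (simp add: diff_mat_def)
  have sym: "diff_mat e n S $$ (a, b) = diff_mat e n S $$ (b, a)" if "a < n" "b < n" for a b
    using diff_mat_symmetric[OF n IG that] .
  have cols: "(\<Sum>a<n. diff_mat e n S $$ (a, b)) = 0" if "b < n" for b
    using that sum_shift[OF n, of "\<lambda>a. S $$ (b, a)" e] by (simp add: diff_mat_def sum_subtractf)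
  have "(\<Sum>b<n. diff_mat e n S $$ (a, b)) = 0" if "a < n" for a
    using cols[OF that] sym[OF that] by simp
  moreover have "(diff_mat e n S)\<^sup>T = diff_mat e n S"
    using carrier sym by (intro eq_matI) auto
  ultimately show ?thesis using carrier cols by (simp add: symmetric_zero_sums_def)
qed

text \<open>
  The minor lets one choose a representing matrix whose distinguished columns are those of a frame;
  isotropy of its first row against the others then forces that row to be constant.
\<close>

lemma IG_frame_exists:
  assumes n: "n \<ge> 1" and X: "X \<in> IG n" and A: "represents (n + 1) (2 * n) A X"
    and minor: "det (submatrix A UNIV (minor_cols e n 0)) \<noteq> 0"
  obtains S where "S \<in> carrier_mat n n" "X = row_span (2 * n) (frame e n S)"
proof -
  \<comment> \<open>A model for the selected columns. They include the one at
    \<open>pos (\<not> e) 0\<close>, so the parameter found below is normalised to have zero column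
    0.\<close>
  let ?Z = "frame e n (0\<^sub>m n n)"
  have n0: "0 < n" using n by simp
  have Ac: "A \<in> carrier_mat (n + 1) (2 * n)" and AX: "row_span (2 * n) A = X"
    using A by (auto simp: represents_def)
  obtain B where B: "B \<in> carrier_mat (n + 1) (2 * n)" and BX: "row_span (2 * n) B = X"
    and colB: "\<And>c. c < 2 * n \<Longrightarrow> c \<in> minor_cols e n 0 \<Longrightarrow> col B c = col ?Z c"
    using row_space_prescribed_columns[OF Ac frame_carrier card_minor_cols[OF n0] minor
        frame_minor_nonzero[OF n0]] AX by blast
  have entry: "B $$ (r, c) = ?Z $$ (r, c)" if "r < n + 1" "c < 2 * n" "c \<in> minor_cols e n 0" for r c
  proof -
    have "B $$ (r, c) = col B c $ r" using that B by simp
    also have "\<dots> = ?Z $$ (r, c)"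
      using that carrier_matD[OF frame_carrier[of e n "0\<^sub>m n n"]] by (simp add: colB)
    finally show ?thesis .
  qed
  have Be: "B $$ (r, pos e j) = ?Z $$ (r, pos e j)" if "r < n + 1" "j < n" for r j
    using entry[of r "pos e j"] that by (simp add: minor_cols_def)
  define S where "S = mat n n (\<lambda>(i, j). (-1) ^ j * B $$ (Suc i, pos (\<not> e) j))"
  define y where "y = row B 0"
  have y0: "coord e y j = 0" if "j < n" for j
    using Be[of 0 j] that B by (simp add: coord_def y_def frame_index)
  have "coord (\<not> e) y (shift e n i) = coord (\<not> e) y i" if i: "i < n" for i
  proof -
    define x where "x = row B (Suc i)"
    have x: "coord e x j = of_bool (j = i)" if "j < n" for j
      using Be[of "Suc i" j] that i B by (simp add: coord_def x_def frame_index)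
    have "x \<in> X" "y \<in> X"
      using row_mem_row_space[OF B] i BX by (auto simp: x_def y_def)
    then have "0 = Omega n x y" using X unfolding IG_def by simp
    \<comment> \<open>The \<open>e\<close> coordinates of \<open>y\<close> vanish and those of
      \<open>x\<close> form the unit vector at \<open>i\<close>, so one term survives.\<close>
    also have "\<dots> = (if e then 1 else -1) *
      (\<Sum>l<n. if l = i then coord (\<not> e) y l - coord (\<not> e) y (shift e n l) else 0)"
      unfolding Omega_coord[OF n, of x y e]
      by (intro arg_cong2[where f = "(*)"] sum.cong) (auto simp: x y0)
    finally show ?thesis using i by (auto split: if_splits)
  qed
  then have "coord (\<not> e) y j = coord (\<not> e) y 0" if "j < n" for j
    using shift_invariant_const[of n "coord (\<not> e) y" e j] that by simp
  \<comment> \<open>The extra selected column fixes the value of the constant.\<close>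
  moreover have "coord (\<not> e) y 0 = 1"
    using entry[of 0 "pos (\<not> e) 0"] n0 B by (simp add: coord_def y_def minor_cols_def frame_index)
  ultimately have y1: "coord (\<not> e) y j = 1" if "j < n" for j using that by simp
  have sq: "(-1) ^ j * ((-1) ^ j * t) = t" for j and t :: real
    by (simp flip: mult.assoc power_mult_distrib)
  have "B = frame e n S"
  proof (rule eq_matI)
    fix r c assume "r < dim_row (frame e n S)" "c < dim_col (frame e n S)"
    then have r: "r < n + 1" and c: "c < 2 * n"
      using carrier_matD[OF frame_carrier[of e n S]] by auto
    show "B $$ (r, c) = frame e n S $$ (r, c)"
      using c
    proof (cases rule: pos_cases[of _ _ e])
      case (1 j)
      then show ?thesis using Be[OF r 1(1)] r by (cases r) (simp_all add: frame_index)
    next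
      case (2 j)
      have "(-1) ^ j * coord (\<not> e) y j = B $$ (0, pos (\<not> e) j)"
        using 2(1) B by (simp add: coord_def y_def sq)
      then have "B $$ (0, pos (\<not> e) j) = (-1) ^ j" using y1[OF 2(1)] by simp
      then show ?thesis using 2 r by (cases r) (simp_all add: frame_index S_def sq)
    qed
  qed (use B carrier_matD[OF frame_carrier[of e n S]] in auto)
  then show thesis using that[of S] BX by (simp add: S_def)
qed

section \<open>The two charts\<close>

lemma mult_D_mat:
  assumes A: "A \<in> carrier_mat k (2 * n)" and "r < k" "c < 2 * n"
  shows "(A * D_mat n) $$ (r, c) = A $$ (r, c) * (-1) ^ (c div 2)"
proof -
  have "(A * D_mat n) $$ (r, c) = (\<Sum>l\<in>{0..<2 * n}. A $$ (r, l) * (if l = c then (-1) ^ (l div 2) else 0))"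
    using assms by (auto simp: D_mat_def scalar_prod_def intro!: sum.cong)
  also have "\<dots> = (\<Sum>l\<in>{0..<2 * n}. if l = c then A $$ (r, l) * (-1) ^ (l div 2) else 0)"
    by (intro sum.cong) auto
  finally show ?thesis using assms by simp
qed

lemma M_mat_D_mat: "M_mat n S * D_mat n = frame True n S"
proof (rule eq_matI)
  fix r c assume "r < dim_row (frame True n S)" "c < dim_col (frame True n S)"
  then have "r < n + 1" "c < 2 * n" by (auto simp: frame_def)
  then show "(M_mat n S * D_mat n) $$ (r, c) = frame True n S $$ (r, c)"
    by (subst mult_D_mat[of _ "n + 1"]) (auto simp: M_mat_def frame_def split: nat.split)
qed (auto simp: M_mat_def D_mat_def frame_def)

lemma M'_mat_D_mat: "M'_mat n T * D_mat n = frame False n T"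
proof (rule eq_matI)
  fix r c assume "r < dim_row (frame False n T)" "c < dim_col (frame False n T)"
  then have "r < n + 1" "c < 2 * n" by (auto simp: frame_def)
  then show "(M'_mat n T * D_mat n) $$ (r, c) = frame False n T $$ (r, c)"
    by (subst mult_D_mat[of _ "n + 1"]) (auto simp: M'_mat_def frame_def split: nat.split)
qed (auto simp: M'_mat_def D_mat_def frame_def)

lemma P_mat_eq: "P_mat n S = diff_mat True n S"
  by (simp add: P_mat_def diff_mat_def shift_def)

lemma Q_mat_eq: "Q_mat n T = diff_mat False n T"
  by (simp add: Q_mat_def diff_mat_def shift_def)

lemma maximal_minor_cols:
  "maximal_minor A {..<n} {k} = det (submatrix A UNIV (minor_cols True n k))"
  "maximal_minor A {k} {..<n} = det (submatrix A UNIV (minor_cols False n k))"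
proof -
  have "minor_cols True n k = col_pos ` {..<n} \<union> tcol_pos ` {k}"
    "minor_cols False n k = col_pos ` {k} \<union> tcol_pos ` {..<n}"
    by (auto simp: minor_cols_def pos_def)
  then show "maximal_minor A {..<n} {k} = det (submatrix A UNIV (minor_cols True n k))"
    "maximal_minor A {k} {..<n} = det (submatrix A UNIV (minor_cols False n k))"
    by (simp_all add: maximal_minor_def)
qed

text \<open>Differencing is inverted by negated partial sums down the columns of \<open>P\<close>; a
  vanishing column sum closes the cycle.\<close>

lemma symmetric_zero_sums_diff_mat:
  assumes n: "n \<ge> 1" and P: "symmetric_zero_sums n P"
  obtains S where "S \<in> carrier_mat n n" "diff_mat True n S = P"
proof
  let ?S = "mat n n (\<lambda>(b, j). - (\<Sum>a<Suc j. P $$ (a, b)))"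
  show "?S \<in> carrier_mat n n" by simp
  have Pc: "P \<in> carrier_mat n n" and cols: "\<And>b. b < n \<Longrightarrow> (\<Sum>a<n. P $$ (a, b)) = 0"
    using P by (auto simp: symmetric_zero_sums_def)
  show "diff_mat True n ?S = P"
  proof (rule eq_matI)
    fix a b assume "a < dim_row P" "b < dim_col P"
    then have a: "a < n" and b: "b < n" using Pc by auto
    show "diff_mat True n ?S $$ (a, b) = P $$ (a, b)"
    proof (cases a)
      case 0
      \<comment> \<open>At the wrap-around the shifted entry is a full column sum of
        \<open>P\<close>, hence 0.\<close>
      then have "shift True n a = n - 1" "Suc (n - 1) = n" using n by (auto simp: shift_def)
      then show ?thesis using 0 a b n cols[OF b]
        by (simp add: diff_mat_def del: sum.lessThan_Suc) simp
    next
      case (Suc l)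
      then have "shift True n a = l" using a by (simp add: shift_def)
      then show ?thesis using Suc a b by (simp add: diff_mat_def)
    qed
  qed (use Pc in \<open>auto simp: diff_mat_def\<close>)
qed

text \<open>Equal differences make each row of \<open>S' - S\<close> invariant under the shift,
  hence constant; its value at column 0 serves as \<open>c i\<close>.\<close>

lemma diff_mat_eqD:
  assumes "diff_mat e n S = diff_mat e n S'" and n: "n \<ge> 1"
  shows "\<exists>c. \<forall>i<n. \<forall>j<n. S' $$ (i, j) = S $$ (i, j) + c i"
proof (intro exI allI impI)
  fix i j assume i: "i < n" and j: "j < n"
  let ?f = "\<lambda>j. S' $$ (i, j) - S $$ (i, j)"
  have "?f (shift e n a) = ?f a" if a: "a < n" for a
  proof -
    have "diff_mat e n S $$ (a, i) = diff_mat e n S' $$ (a, i)" using assms(1) by simp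
    then show ?thesis using a i by (simp add: diff_mat_def)
  qed
  from shift_invariant_const[of n ?f e, OF this j]
  show "S' $$ (i, j) = S $$ (i, j) + (S' $$ (i, 0) - S $$ (i, 0))" by simp
qed

theorem theorem1p2:
  fixes n :: nat
  assumes "n \<ge> 1"
  shows
    "(\<forall>X \<in> U_not_shorted n.
        (\<exists>S \<in> carrier_mat n n. X = row_span (2 * n) (M_mat n S * D_mat n)) \<and>
        (\<forall>S \<in> carrier_mat n n. X = row_span (2 * n) (M_mat n S * D_mat n) \<longrightarrow>
           (\<forall>S' \<in> carrier_mat n n.
              X = row_span (2 * n) (M_mat n S' * D_mat n) \<longleftrightarrow>
              (\<exists>c :: nat \<Rightarrow> real. \<forall>i<n. \<forall>j<n. S' $$ (i, j) = S $$ (i, j) + c i)) \<and>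
           symmetric_zero_sums n (P_mat n S))) \<and>
     (\<forall>P. symmetric_zero_sums n P \<longrightarrow>
        (\<exists>!X. X \<in> U_not_shorted n \<and>
           (\<exists>S \<in> carrier_mat n n.
              X = row_span (2 * n) (M_mat n S * D_mat n) \<and> P = P_mat n S))) \<and>
     (\<forall>X \<in> U_connected n.
        (\<exists>T \<in> carrier_mat n n. X = row_span (2 * n) (M'_mat n T * D_mat n)) \<and>
        (\<forall>T \<in> carrier_mat n n. X = row_span (2 * n) (M'_mat n T * D_mat n) \<longrightarrow>
           symmetric_zero_sums n (Q_mat n T)))"
  unfolding M_mat_D_mat M'_mat_D_mat P_mat_eq Q_mat_eq
proof (intro conjI ballI allI impI)
  note n = assms
  have n0: "0 < n" using n by simp
  {
    fix X assume X: "X \<in> U_not_shorted n"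
    then have IG: "X \<in> IG n" by (simp add: U_not_shorted_def)
    obtain A where A: "represents (n + 1) (2 * n) A X"
      "det (submatrix A UNIV (minor_cols True n 0)) \<noteq> 0"
      using X n0 unfolding U_not_shorted_def plucker_nonzero_def maximal_minor_cols by blast
    show "\<exists>S\<in>carrier_mat n n. X = row_span (2 * n) (frame True n S)"
      using IG_frame_exists[OF n IG A] by blast
    fix S assume XS: "X = row_span (2 * n) (frame True n S)"
    show "symmetric_zero_sums n (diff_mat True n S)"
      using diff_mat_symmetric_zero_sums[OF n] IG XS by simp
    show "X = row_span (2 * n) (frame True n S') \<longleftrightarrow>
        (\<exists>c :: nat \<Rightarrow> real. \<forall>i<n. \<forall>j<n. S' $$ (i, j) = S $$ (i, j) + c i)" for S'
      unfolding XS by (rule row_space_frame_eq_iff)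
  next
    fix X assume X: "X \<in> U_connected n"
    then have IG: "X \<in> IG n" by (simp add: U_connected_def)
    obtain A where A: "represents (n + 1) (2 * n) A X"
      "det (submatrix A UNIV (minor_cols False n 0)) \<noteq> 0"
      using X n0 unfolding U_connected_def plucker_nonzero_def maximal_minor_cols by blast
    show "\<exists>T\<in>carrier_mat n n. X = row_span (2 * n) (frame False n T)"
      using IG_frame_exists[OF n IG A] by blast
    fix T assume XT: "X = row_span (2 * n) (frame False n T)"
    show "symmetric_zero_sums n (diff_mat False n T)"
      using diff_mat_symmetric_zero_sums[OF n] IG XT by simp
  next
    fix P assume P: "symmetric_zero_sums n P"
    obtain S where S: "S \<in> carrier_mat n n" and PS: "diff_mat True n S = P"
      using symmetric_zero_sums_diff_mat[OF n P] .
    have "P $$ (a, b) = P $$ (b, a)" if "a < n" "b < n" for a b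
    proof -
      have "P \<in> carrier_mat n n" "P\<^sup>T = P" using P by (auto simp: symmetric_zero_sums_def)
      then show ?thesis using that by (metis carrier_matD index_transpose_mat(1))
    qed
    then have "row_span (2 * n) (frame True n S) \<in> IG n" using frame_in_IG[OF n, of True S] PS by simp
    moreover have "plucker_nonzero n (row_span (2 * n) (frame True n S)) {..<n} {k}" if "k < n" for k
      unfolding plucker_nonzero_def maximal_minor_cols represents_def
      using frame_minor_nonzero[OF that] frame_carrier by blast
    ultimately have "row_span (2 * n) (frame True n S) \<in> U_not_shorted n"
      by (simp add: U_not_shorted_def)
    \<comment> \<open>Uniqueness of the point: parameters with the same differences agree up to row
      constants, and these leave the span unchanged.\<close>
    moreover have "row_span (2 * n) (frame True n S') = row_span (2 * n) (frame True n S)"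
      if "P = diff_mat True n S'" for S'
      unfolding row_space_frame_eq_iff using diff_mat_eqD[OF _ n, of True S' S] that PS by simp
    ultimately have "X \<in> U_not_shorted n \<and>
        (\<exists>S'\<in>carrier_mat n n. X = row_span (2 * n) (frame True n S') \<and> P = diff_mat True n S')
      \<longleftrightarrow> X = row_span (2 * n) (frame True n S)" for X
      using S PS by metis
    then show "\<exists>!X. X \<in> U_not_shorted n \<and>
        (\<exists>S\<in>carrier_mat n n. X = row_span (2 * n) (frame True n S) \<and> P = diff_mat True n S)"
      by simp
  }
qed

end
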